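(* Let $\beta>0$ and $\gamma>0$. Let $\mathcal{S}^{\beta}_k\in X^{0,\beta}_k$, $k\ge1$, be the Sobolev orthogonal Laguerre functions such that $\mathcal{S}^{\beta}_k-l^{-1,\beta}_k\in X^{0,\beta}_{k-1}$ and $$A_{\gamma}(\mathcal{S}^{\beta}_k,\mathcal{S}^{\beta}_m)=\varrho_k\,\delta_{k,m},\qquad k,m\ge1.$$ Then $$\mathcal{S}^{\beta}_1(x)=l^{-1,\beta}_1(x),\qquad \mathcal{S}^{\beta}_k(x)=l^{-1,\beta}_k(x)-d_{k-1}\mathcal{S}^{\beta}_{k-1}(x),\quad k\ge2,$$ where $\varrho_1=\dfrac{4\gamma+\beta^2}{2\beta}$ and $$d_{k-1}=\frac{\beta}{4\varrho_{k-1}}-\frac{\gamma}{\beta\varrho_{k-1}},\qquad \varrho_k=-d_{k-1}^2\varrho_{k-1}+\frac{\beta}{2}+\frac{2\gamma}{\beta},\qquad k\ge2.$$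
   Context: $\Lambda=(0,\infty)$, $(u,v)=\int_\Lambda uv\,dx$, $\mathbb{P}_N$ is the space of real polynomials of degree $\le N$, and $\delta_{k,m}$ is the Kronecker symbol. $X^{0,\beta}_N=\{e^{-\frac12\beta x}p(x):p\in\mathbb{P}_N,\ p(0)=0\}$ (so $X^{0,\beta}_0=\{0\}$). The bilinear form is $A_{\gamma}(u,v)=(u',v')+\gamma(u,v)$. For $a\in\mathbb{R}$ let $(a)_n=a(a+1)\cdots(a+n-1)$, $(a)_0=1$. For $\alpha\in\mathbb{R}$, $\mathcal{L}^{\alpha}_k(x)=\sum_{\nu=0}^{k}\frac{(\alpha+\nu+1)_{k-\nu}}{(k-\nu)!\,\nu!}(-x)^{\nu}$ and $l^{\alpha,\beta}_k(x)=e^{-\frac12\beta x}\mathcal{L}^{\alpha}_k(\beta x)$, $k\ge0$; here $\alpha=-1$ is used. *)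

theory Defs
  imports "HOL-Analysis.Analysis" "HOL-Computational_Algebra.Polynomial"
begin

(* Functions on the half-line (0,infinity) are represented by total functions real => real;
   all notions below depend only on the values at x > 0. *)

definition ip :: "(real \<Rightarrow> real) \<Rightarrow> (real \<Rightarrow> real) \<Rightarrow> real" where
  "ip u v = (LBINT x:{0<..}. u x * v x)"

definition sobolev_form :: "real \<Rightarrow> (real \<Rightarrow> real) \<Rightarrow> (real \<Rightarrow> real) \<Rightarrow> real" where
  "sobolev_form \<gamma> u v = ip (deriv u) (deriv v) + \<gamma> * ip u v"

definition X0 :: "real \<Rightarrow> nat \<Rightarrow> (real \<Rightarrow> real) set" where
  "X0 \<beta> N = {u. \<exists>p :: real poly. degree p \<le> N \<and> poly p 0 = 0 \<and>
                 (\<forall>x>0. u x = exp (- (1/2) * \<beta> * x) * poly p x)}"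

definition laguerre :: "real \<Rightarrow> nat \<Rightarrow> real \<Rightarrow> real" where
  "laguerre \<alpha> k x =
     (\<Sum>\<nu>=0..k. pochhammer (\<alpha> + real \<nu> + 1) (k - \<nu>) / (fact (k - \<nu>) * fact \<nu>) * (- x) ^ \<nu>)"

definition laguerre_fun :: "real \<Rightarrow> real \<Rightarrow> nat \<Rightarrow> real \<Rightarrow> real" where
  "laguerre_fun \<alpha> \<beta> k x = exp (- (1/2) * \<beta> * x) * laguerre \<alpha> k (\<beta> * x)"

end

theory Submission
  imports Defs "HOL-Probability.Distributions"
begin

text \<open>
  On the half-line, the functions \<open>l\<^sub>k = laguerre_fun (-1) \<beta> k\<close> with \<open>1 \<le> k \<le> n\<close> form a basis of
  \<open>X0 \<beta> n\<close> for every \<open>n\<close>, and the \<open>S k\<close> are what Gram--Schmidt makes of them. The recurrence has only two terms because the Gram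
  matrix of this basis under \<open>A\<^sub>\<gamma>\<close> is tridiagonal. Indeed, let \<open>L\<^sub>k\<close> be the classical Laguerre
  polynomials in \<open>\<beta> x\<close>; then
    \<open>l\<^sub>k = exp (- \<beta> x / 2) (L\<^sub>k - L\<^sub>k\<^sub>-\<^sub>1)\<close> and \<open>l\<^sub>k' = - (\<beta> / 2) exp (- \<beta> x / 2) (L\<^sub>k + L\<^sub>k\<^sub>-\<^sub>1)\<close>,
  so the orthogonality \<open>\<integral> exp (- \<beta> x) L\<^sub>j L\<^sub>k = \<delta>\<^sub>j\<^sub>k / \<beta>\<close> gives
    \<open>A\<^sub>\<gamma>(l\<^sub>k, l\<^sub>k) = \<beta> / 2 + 2 \<gamma> / \<beta> = a\<close> and \<open>A\<^sub>\<gamma>(l\<^sub>k, l\<^sub>k\<^sub>-\<^sub>1) = \<beta> / 4 - \<gamma> / \<beta> = b\<close>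
  and zero for all other pairs (\<open>poly_form_laguerre_diff\<close>).

  Consequently \<open>l\<^sub>k\<close> is orthogonal to \<open>S\<^sub>i\<close> for \<open>i < k - 1\<close>, and \<open>A\<^sub>\<gamma>(l\<^sub>k, S\<^sub>k\<^sub>-\<^sub>1) = b\<close>. The function
  \<open>w = S\<^sub>k - l\<^sub>k + (b / \<rho>\<^sub>k\<^sub>-\<^sub>1) S\<^sub>k\<^sub>-\<^sub>1\<close> lies in \<open>X0 \<beta> (k - 1)\<close>, which is spanned by the \<open>S\<^sub>i\<close> with \<open>i < k\<close>,
  and is orthogonal to all of them; so it vanishes as soon as the \<open>\<rho>\<^sub>i\<close> do not. Pairing the resulting
  formula for \<open>S\<^sub>k\<close> with itself gives \<open>\<rho>\<^sub>k = a - b\<^sup>2 / \<rho>\<^sub>k\<^sub>-\<^sub>1\<close>, and this in turn keeps \<open>\<rho>\<^sub>k \<ge> a / 2 > 0\<close>,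
  because \<open>b\<^sup>2 \<le> (a / 2)\<^sup>2\<close>. The recurrence and the positivity of \<open>\<rho>\<close> are thus proved by one
  induction (\<open>sobolev_laguerre_recurrence\<close>).

  Dividing out \<open>exp (- \<beta> x / 2)\<close> turns all of this into a computation with polynomials: the form
  becomes \<open>poly_form\<close>, built from the linear functional \<open>exp_integral\<close>.
\<close>

section \<open>Polynomials integrated against an exponential weight\<close>

definition exp_integral :: "real \<Rightarrow> real poly \<Rightarrow> real" where
  "exp_integral \<beta> p = (LBINT x:{0<..}. exp (- \<beta> * x) * poly p x)"

text \<open>
  Up to normalisation the integrand is the Erlang density, whose total mass is one. The density
  includes the point zero, which the half-line omits, so the two agree only almost everywhere.
\<close>

lemma has_bochner_integral_exp_power:
  fixes \<beta> :: real
  assumes "\<beta> > 0"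
  shows "has_bochner_integral lborel (\<lambda>x. indicator {0<..} x *\<^sub>R (exp (- \<beta> * x) * x ^ n))
           (fact n / \<beta> ^ Suc n)"
proof -
  have "has_bochner_integral lborel (erlang_density n \<beta>) 1"
  proof (rule has_bochner_integral_nn_integral)
    show "AE x in lborel. 0 \<le> erlang_density n \<beta> x"
      using assms by simp
    show "(\<integral>\<^sup>+ x. ennreal (erlang_density n \<beta> x) \<partial>lborel) = ennreal 1"
      using nn_integral_erlang_ith_moment[OF assms, of n 0] by simp
  qed simp_all
  then have "has_bochner_integral lborel (\<lambda>x. (fact n / \<beta> ^ Suc n) *\<^sub>R erlang_density n \<beta> x)
      ((fact n / \<beta> ^ Suc n) *\<^sub>R 1)"
    by (rule has_bochner_integral_scaleR_right)
  then have *: "has_bochner_integral lborel (\<lambda>x. (fact n / \<beta> ^ Suc n) * erlang_density n \<beta> x)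
      (fact n / \<beta> ^ Suc n)"
    by simp
  have eq: "AE x in lborel. (fact n / \<beta> ^ Suc n) * erlang_density n \<beta> x
      = indicator {0<..} x *\<^sub>R (exp (- \<beta> * x) * x ^ n)"
    using AE_lborel_singleton[of 0]
    by eventually_elim (use assms in \<open>auto simp: erlang_density_def indicator_def field_simps\<close>)
  have meas: "(\<lambda>x. indicator {0<..} x *\<^sub>R (exp (- \<beta> * x) * x ^ n)) \<in> borel_measurable lborel"
    by measurable
  show ?thesis
    using has_bochner_integral_cong_AE[THEN iffD1, OF _ meas eq *] by simp
qed

lemma set_integrable_exp_poly:
  fixes p :: "real poly"
  assumes "\<beta> > 0"
  shows "set_integrable lborel {0<..} (\<lambda>x. exp (- \<beta> * x) * poly p x)"
proof -
  have "integrable lborel (\<lambda>x. \<Sum>i\<le>degree p. coeff p i *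
      (indicator {0<..} x *\<^sub>R (exp (- \<beta> * x) * x ^ i)))"
    using has_bochner_integral_exp_power[OF assms]
    by (intro Bochner_Integration.integrable_sum integrable_mult_right) (rule integrable.intros)
  moreover have "(\<lambda>x. \<Sum>i\<le>degree p. coeff p i * (indicator {0<..} x *\<^sub>R (exp (- \<beta> * x) * x ^ i)))
      = (\<lambda>x. indicator {0<..} x *\<^sub>R (exp (- \<beta> * x) * poly p x))"
    by (simp add: poly_altdef sum_distrib_left mult_ac)
  ultimately show ?thesis
    by (simp add: set_integrable_def)
qed

lemma exp_integral_add:
  assumes "\<beta> > 0"
  shows "exp_integral \<beta> (p + q) = exp_integral \<beta> p + exp_integral \<beta> q"
  unfolding exp_integral_def
  using set_integral_add(2)[OF set_integrable_exp_poly[OF assms, of p]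
      set_integrable_exp_poly[OF assms, of q]]
  by (simp add: algebra_simps)

lemma exp_integral_smult: "exp_integral \<beta> (smult c p) = c * exp_integral \<beta> p"
proof -
  have "exp_integral \<beta> (smult c p) = (LBINT x:{0<..}. c * (exp (- \<beta> * x) * poly p x))"
    by (simp add: exp_integral_def mult_ac)
  then show ?thesis
    by (simp add: exp_integral_def)
qed

lemma exp_integral_0: "exp_integral \<beta> 0 = 0"
  using exp_integral_smult[of \<beta> 0 0] by simp

lemma exp_integral_uminus: "exp_integral \<beta> (- p) = - exp_integral \<beta> p"
  using exp_integral_smult[of \<beta> "-1" p] by simp

lemma exp_integral_diff:
  assumes "\<beta> > 0"
  shows "exp_integral \<beta> (p - q) = exp_integral \<beta> p - exp_integral \<beta> q"
  using exp_integral_add[OF assms, of p "- q"] by (simp add: exp_integral_uminus)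

lemma exp_integral_sum:
  assumes "\<beta> > 0"
  shows "exp_integral \<beta> (\<Sum>i\<in>A. f i) = (\<Sum>i\<in>A. exp_integral \<beta> (f i))"
  by (induction A rule: infinite_finite_induct)
     (simp_all add: exp_integral_0 exp_integral_add[OF assms])

lemma exp_integral_monom:
  assumes "\<beta> > 0"
  shows "exp_integral \<beta> (monom c n) = c * (fact n / \<beta> ^ Suc n)"
proof -
  have "exp_integral \<beta> (monom 1 n) = fact n / \<beta> ^ Suc n"
    using has_bochner_integral_integral_eq[OF has_bochner_integral_exp_power[OF assms, of n]]
    by (simp add: exp_integral_def set_lebesgue_integral_def poly_monom)
  moreover have "monom c n = smult c (monom 1 n)"
    by (simp add: smult_monom)
  ultimately show ?thesis
    by (simp only: exp_integral_smult)
qed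

text \<open>
  Integration by parts. By linearity it suffices to check it on monomials, where it is the
  recursion of the factorial in the moments \<open>n! / \<beta>\<^sup>n\<^sup>+\<^sup>1\<close>; no limit at infinity has to be discussed.
\<close>

lemma exp_integral_pderiv:
  assumes "\<beta> > 0"
  shows "exp_integral \<beta> (pderiv p) = \<beta> * exp_integral \<beta> p - poly p 0"
proof -
  have const: "exp_integral \<beta> [:c:] = c / \<beta>" for c :: real
    using exp_integral_monom[OF assms, of c 0] by (simp add: monom_0)
  have monom_case: "exp_integral \<beta> (pderiv (monom c n))
      = \<beta> * exp_integral \<beta> (monom c n) - poly (monom c n) 0" for c :: real and n
    using assms
    by (cases n) (simp_all add: pderiv_monom exp_integral_monom exp_integral_0 poly_monom
        monom_0 const field_simps)
  let ?m = "\<lambda>i. monom (coeff p i) i"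
  have p: "(\<Sum>i\<le>degree p. ?m i) = p"
    by (rule poly_as_sum_of_monoms)
  have "exp_integral \<beta> (pderiv (\<Sum>i\<le>degree p. ?m i))
      = (\<Sum>i\<le>degree p. \<beta> * exp_integral \<beta> (?m i) - poly (?m i) 0)"
    by (simp add: higher_pderiv_sum[of 1, simplified] exp_integral_sum[OF assms] monom_case)
  also have "\<dots> = \<beta> * exp_integral \<beta> (\<Sum>i\<le>degree p. ?m i) - poly (\<Sum>i\<le>degree p. ?m i) 0"
    by (simp add: sum_subtractf sum_distrib_left exp_integral_sum[OF assms] poly_sum)
  finally show ?thesis
    by (simp only: p)
qed

section \<open>Orthogonality of the scaled Laguerre polynomials\<close>

text \<open>
  The classical Laguerre polynomial, with parameter zero, in the variable \<open>\<beta> x\<close>.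
\<close>

definition laguerre_poly :: "real \<Rightarrow> nat \<Rightarrow> real poly" where
  "laguerre_poly \<beta> k = (\<Sum>\<nu>\<le>k. monom ((- \<beta>) ^ \<nu> * real (k choose \<nu>) / fact \<nu>) \<nu>)"

lemma coeff_laguerre_poly:
  "coeff (laguerre_poly \<beta> k) \<nu> = (- \<beta>) ^ \<nu> * real (k choose \<nu>) / fact \<nu>"
  by (cases "\<nu> \<le> k") (simp_all add: laguerre_poly_def coeff_sum if_distrib cong: if_cong)

lemma laguerre_poly_0 [simp]: "laguerre_poly \<beta> 0 = 1"
  by (simp add: laguerre_poly_def monom_0 one_pCons)

lemma poly_laguerre_poly_0 [simp]: "poly (laguerre_poly \<beta> k) 0 = 1"
  by (simp add: poly_0_coeff_0 coeff_laguerre_poly)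

text \<open>
  In coefficients this is Pascal's rule. All further facts about Laguerre polynomials rest on it.
\<close>

lemma pderiv_laguerre_poly_Suc:
  "pderiv (laguerre_poly \<beta> (Suc k)) = pderiv (laguerre_poly \<beta> k) - smult \<beta> (laguerre_poly \<beta> k)"
proof (rule poly_eqI)
  fix \<nu>
  show "coeff (pderiv (laguerre_poly \<beta> (Suc k))) \<nu>
      = coeff (pderiv (laguerre_poly \<beta> k) - smult \<beta> (laguerre_poly \<beta> k)) \<nu>"
    by (simp add: coeff_pderiv coeff_laguerre_poly field_simps del: of_nat_Suc)
qed

text \<open>
  The difference \<open>\<Lambda> = L\<^sub>k\<^sub>+\<^sub>1 - L\<^sub>k\<close> vanishes at zero, so integrating \<open>(\<Lambda> L\<^sub>j)'\<close> by parts leaves no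
  boundary term; substituting \<open>\<Lambda>' = - \<beta> L\<^sub>k\<close> and \<open>L\<^sub>j' - \<beta> L\<^sub>j = L\<^sub>j\<^sub>+\<^sub>1'\<close> gives the shift. Iterating it
  moves either index down to zero, where the integrals are immediate.
\<close>

lemma exp_integral_laguerre_shift:
  assumes "\<beta> > 0"
  shows "exp_integral \<beta> (laguerre_poly \<beta> (Suc k) * pderiv (laguerre_poly \<beta> (Suc j)))
       = exp_integral \<beta> (laguerre_poly \<beta> k * pderiv (laguerre_poly \<beta> j))"
proof -
  let ?L = "laguerre_poly \<beta>"
  let ?\<Lambda> = "?L (Suc k) - ?L k"
  have "exp_integral \<beta> (pderiv (?\<Lambda> * ?L j)) = \<beta> * exp_integral \<beta> (?\<Lambda> * ?L j)"
    by (simp add: exp_integral_pderiv[OF assms])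
  moreover have "pderiv (?\<Lambda> * ?L j) = ?\<Lambda> * pderiv (?L j) - smult \<beta> (?L k * ?L j)"
    by (simp add: pderiv_mult pderiv_diff pderiv_laguerre_poly_Suc algebra_simps)
  ultimately have "exp_integral \<beta> (?\<Lambda> * pderiv (?L j)) - \<beta> * exp_integral \<beta> (?L k * ?L j)
      = \<beta> * exp_integral \<beta> (?\<Lambda> * ?L j)"
    by (simp add: exp_integral_diff[OF assms] exp_integral_smult)
  then show ?thesis
    by (simp add: pderiv_laguerre_poly_Suc algebra_simps exp_integral_diff[OF assms]
        exp_integral_smult)
qed

lemma exp_integral_laguerre_pderiv_le:
  assumes "\<beta> > 0" and "j \<le> k"
  shows "exp_integral \<beta> (laguerre_poly \<beta> k * pderiv (laguerre_poly \<beta> j)) = 0"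
  using \<open>j \<le> k\<close>
proof (induction j arbitrary: k)
  case 0
  then show ?case
    by (simp add: exp_integral_0)
next
  case (Suc j)
  then obtain k' where "k = Suc k'" "j \<le> k'"
    by (cases k) auto
  with Suc.IH show ?case
    by (simp add: exp_integral_laguerre_shift[OF assms(1)])
qed

lemma exp_integral_laguerre_pderiv_Suc:
  assumes "\<beta> > 0"
  shows "exp_integral \<beta> (laguerre_poly \<beta> k * pderiv (laguerre_poly \<beta> (Suc k))) = - 1"
proof (induction k)
  case 0
  have "exp_integral \<beta> (smult \<beta> 1) = 1"
    using exp_integral_monom[OF assms, of 1 0] assms
    by (simp only: exp_integral_smult) (simp add: monom_0 one_pCons)
  then show ?case
    by (simp add: pderiv_laguerre_poly_Suc exp_integral_uminus pderiv_1 del: minus_pCons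
        flip: minus_pCons)
next
  case (Suc k)
  then show ?case
    by (simp add: exp_integral_laguerre_shift[OF assms])
qed

text \<open>
  Writing \<open>\<beta> L\<^sub>j = L\<^sub>j' - L\<^sub>j\<^sub>+\<^sub>1'\<close> reduces the case \<open>j \<le> k\<close> to the two preceding lemmas; the remaining
  case follows by symmetry.
\<close>

lemma laguerre_orthogonal:
  assumes "\<beta> > 0"
  shows "exp_integral \<beta> (laguerre_poly \<beta> k * laguerre_poly \<beta> j) = (if k = j then 1 / \<beta> else 0)"
proof -
  let ?L = "laguerre_poly \<beta>"
  have key: "\<beta> * exp_integral \<beta> (?L k * ?L j)
      = exp_integral \<beta> (?L k * pderiv (?L j)) - exp_integral \<beta> (?L k * pderiv (?L (Suc j)))" for k j
    by (simp add: pderiv_laguerre_poly_Suc algebra_simps exp_integral_diff[OF assms]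
        exp_integral_smult)
  have less: "exp_integral \<beta> (?L k * ?L j) = 0" if "j < k" for k j
    using key[of k j] that assms by (simp add: exp_integral_laguerre_pderiv_le)
  have "exp_integral \<beta> (?L k * ?L k) = 1 / \<beta>"
    using key[of k k] assms
    by (simp add: exp_integral_laguerre_pderiv_le exp_integral_laguerre_pderiv_Suc field_simps)
  then show ?thesis
    using less[of j k] less[of k j] by (cases k j rule: linorder_cases) (auto simp: mult.commute)
qed

section \<open>The Sobolev form on polynomials\<close>

text \<open>
  This is differentiation conjugated by the weight: \<open>exp (- \<beta> x / 2) p\<close> has the derivative
  \<open>exp (- \<beta> x / 2) (weighted_deriv \<beta> p)\<close>.
\<close>

definition weighted_deriv :: "real \<Rightarrow> real poly \<Rightarrow> real poly" where
  "weighted_deriv \<beta> p = pderiv p - smult (\<beta> / 2) p"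

definition poly_form :: "real \<Rightarrow> real \<Rightarrow> real poly \<Rightarrow> real poly \<Rightarrow> real" where
  "poly_form \<beta> \<gamma> p q = exp_integral \<beta> (weighted_deriv \<beta> p * weighted_deriv \<beta> q)
     + \<gamma> * exp_integral \<beta> (p * q)"

lemma poly_form_commute: "poly_form \<beta> \<gamma> p q = poly_form \<beta> \<gamma> q p"
  by (simp add: poly_form_def mult.commute)

lemma poly_form_add_left:
  assumes "\<beta> > 0"
  shows "poly_form \<beta> \<gamma> (p + q) r = poly_form \<beta> \<gamma> p r + poly_form \<beta> \<gamma> q r"
proof -
  have "weighted_deriv \<beta> (p + q) = weighted_deriv \<beta> p + weighted_deriv \<beta> q"
    by (simp add: weighted_deriv_def pderiv_add smult_add_right)
  then show ?thesis
    by (simp add: poly_form_def distrib_right exp_integral_add[OF assms] distrib_left)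
qed

lemma poly_form_smult_left: "poly_form \<beta> \<gamma> (smult c p) r = c * poly_form \<beta> \<gamma> p r"
proof -
  have "weighted_deriv \<beta> (smult c p) = smult c (weighted_deriv \<beta> p)"
    by (simp add: weighted_deriv_def pderiv_smult smult_diff_right mult.commute)
  then show ?thesis
    by (simp add: poly_form_def exp_integral_smult algebra_simps)
qed

lemma poly_form_0_left: "poly_form \<beta> \<gamma> 0 r = 0"
  using poly_form_smult_left[of \<beta> \<gamma> 0 0 r] by simp

lemma poly_form_diff_left:
  assumes "\<beta> > 0"
  shows "poly_form \<beta> \<gamma> (p - q) r = poly_form \<beta> \<gamma> p r - poly_form \<beta> \<gamma> q r"
  using poly_form_add_left[OF assms, of \<gamma> p "smult (-1) q" r] poly_form_smult_left[of \<beta> \<gamma> "-1" q r]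
  by simp

lemma poly_form_sum_left:
  assumes "\<beta> > 0"
  shows "poly_form \<beta> \<gamma> (\<Sum>i\<in>A. f i) r = (\<Sum>i\<in>A. poly_form \<beta> \<gamma> (f i) r)"
  by (induction A rule: infinite_finite_induct)
     (simp_all add: poly_form_0_left poly_form_add_left[OF assms])

text \<open>
  The functions are controlled only for \<open>x > 0\<close>. This determines their derivatives there as well,
  because the half-line is open, and the product of the two factors \<open>exp (- \<beta> x / 2)\<close> is the weight.
\<close>

lemma sobolev_form_exp_poly:
  fixes u v :: "real \<Rightarrow> real"
  assumes u: "\<And>x. x > 0 \<Longrightarrow> u x = exp (- (1/2) * \<beta> * x) * poly p x"
    and v: "\<And>x. x > 0 \<Longrightarrow> v x = exp (- (1/2) * \<beta> * x) * poly q x"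
  shows "sobolev_form \<gamma> u v = poly_form \<beta> \<gamma> p q"
proof -
  have deriv_eq: "deriv w x = exp (- (1/2) * \<beta> * x) * poly (weighted_deriv \<beta> r) x"
    if w: "\<And>x. x > 0 \<Longrightarrow> w x = exp (- (1/2) * \<beta> * x) * poly r x" and "x > 0"
    for w :: "real \<Rightarrow> real" and r x
  proof (rule DERIV_imp_deriv)
    have "((\<lambda>x. exp (- (1/2) * \<beta> * x) * poly r x) has_field_derivative
        exp (- (1/2) * \<beta> * x) * poly (weighted_deriv \<beta> r) x) (at x)"
      by (auto intro!: derivative_eq_intros simp: weighted_deriv_def algebra_simps)
    then show "(w has_field_derivative exp (- (1/2) * \<beta> * x) * poly (weighted_deriv \<beta> r) x) (at x)"
      by (rule has_field_derivative_transform_within_open[where S = "{0<..}"])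
         (use w \<open>x > 0\<close> in auto)
  qed
  have ip_eq: "ip f g = exp_integral \<beta> (r * s)"
    if f: "\<And>x. x > 0 \<Longrightarrow> f x = exp (- (1/2) * \<beta> * x) * poly r x"
      and g: "\<And>x. x > 0 \<Longrightarrow> g x = exp (- (1/2) * \<beta> * x) * poly s x"
    for f g :: "real \<Rightarrow> real" and r s
    unfolding ip_def exp_integral_def
  proof (rule set_lebesgue_integral_cong)
    show "\<forall>x. x \<in> {0<..} \<longrightarrow> f x * g x = exp (- \<beta> * x) * poly (r * s) x"
    proof (intro allI impI)
      fix x :: real
      assume "x \<in> {0<..}"
      moreover have "exp (- \<beta> * x) = exp (- (1/2) * \<beta> * x) * exp (- (1/2) * \<beta> * x)"
        by (simp flip: exp_add)
      ultimately show "f x * g x = exp (- \<beta> * x) * poly (r * s) x"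
        by (simp only: f g greaterThan_iff poly_mult mult_ac)
    qed
  qed simp
  show ?thesis
    unfolding sobolev_form_def poly_form_def
    by (simp only: ip_eq[OF u v] ip_eq[OF deriv_eq[OF u] deriv_eq[OF v]])
qed

text \<open>
  For \<open>k \<ge> 1\<close> this is the Laguerre polynomial with parameter \<open>-1\<close> in the variable \<open>\<beta> x\<close>; for \<open>k = 0\<close> the
  truncated subtraction makes it zero.
\<close>

definition laguerre_diff :: "real \<Rightarrow> nat \<Rightarrow> real poly" where
  "laguerre_diff \<beta> k = laguerre_poly \<beta> k - laguerre_poly \<beta> (k - 1)"

lemma degree_laguerre_diff: "degree (laguerre_diff \<beta> k) \<le> k"
  by (rule degree_le) (simp add: laguerre_diff_def coeff_laguerre_poly binomial_eq_0)

lemma poly_laguerre_diff_0: "poly (laguerre_diff \<beta> k) 0 = 0"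
  by (simp add: laguerre_diff_def)

lemma coeff_laguerre_diff:
  assumes "k \<ge> 1"
  shows "coeff (laguerre_diff \<beta> k) k = (- \<beta>) ^ k / fact k"
  using assms by (simp add: laguerre_diff_def coeff_laguerre_poly binomial_eq_0)

lemma pochhammer_of_nat_eq:
  "pochhammer (real (Suc \<nu>)) m = fact (\<nu> + m) / fact \<nu>"
  using pochhammer_product[of \<nu> "\<nu> + m" "1 :: real"]
  by (simp add: pochhammer_fact[symmetric] add.commute field_simps)

text \<open>
  The coefficients agree by Pascal's rule: for \<open>1 \<le> \<nu> \<le> k\<close> both sides have
  \<open>(k - 1 choose \<nu> - 1) / \<nu>!\<close> at \<open>(- \<beta> x)\<^sup>\<nu>\<close>. The constant term is zero on the left because the
  Pochhammer symbol then starts with the factor zero.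
\<close>

lemma laguerre_minus_one_eq:
  assumes "k \<ge> 1"
  shows "laguerre (-1) k (\<beta> * x) = poly (laguerre_diff \<beta> k) x"
proof -
  have coeff_eq: "pochhammer (- 1 + real \<nu> + 1) (k - \<nu>) / (fact (k - \<nu>) * fact \<nu>) * (- (\<beta> * x)) ^ \<nu>
      = coeff (laguerre_diff \<beta> k) \<nu> * x ^ \<nu>" if "\<nu> \<le> k" for \<nu>
  proof (cases \<nu>)
    case 0
    with assms show ?thesis
      by (cases k) (simp_all add: laguerre_diff_def coeff_laguerre_poly pochhammer_0_left)
  next
    case (Suc \<mu>)
    with that obtain l where l: "k = Suc l" "\<mu> \<le> l"
      by (cases k) auto
    have "k - \<nu> = l - \<mu>"
      using l Suc by simp
    moreover have "pochhammer (- 1 + real \<nu> + 1) (l - \<mu>) = fact l / fact \<mu>"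
      using pochhammer_of_nat_eq[of \<mu> "l - \<mu>"] l Suc by (simp add: add.commute)
    moreover have "coeff (laguerre_diff \<beta> k) \<nu> = (- \<beta>) ^ \<nu> * real (l choose \<mu>) / fact \<nu>"
      using l Suc by (simp add: laguerre_diff_def coeff_laguerre_poly field_simps del: fact_Suc)
    moreover have "real (l choose \<mu>) = fact l / (fact \<mu> * fact (l - \<mu>))"
      using l by (simp add: binomial_fact)
    moreover have "(- (\<beta> * x)) ^ \<nu> = (- \<beta>) ^ \<nu> * x ^ \<nu>"
      by (simp flip: power_mult_distrib)
    ultimately show ?thesis
      by (simp only:) (simp add: mult_ac)
  qed
  have "poly (laguerre_diff \<beta> k) x = (\<Sum>\<nu>\<le>k. coeff (laguerre_diff \<beta> k) \<nu> * x ^ \<nu>)"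
    using arg_cong[OF poly_as_sum_of_monoms'[OF degree_laguerre_diff[of \<beta> k]],
        of "\<lambda>p. poly p x"]
    by (simp add: poly_sum poly_monom)
  also have "\<dots> = laguerre (-1) k (\<beta> * x)"
    unfolding laguerre_def atLeast0AtMost by (intro sum.cong refl) (simp only: coeff_eq atMost_iff)
  finally show ?thesis ..
qed

lemma weighted_deriv_laguerre_diff:
  assumes "k \<ge> 1"
  shows "weighted_deriv \<beta> (laguerre_diff \<beta> k)
       = smult (- \<beta> / 2) (laguerre_poly \<beta> k + laguerre_poly \<beta> (k - 1))"
proof (rule poly_eqI)
  fix n
  obtain l where "k = Suc l"
    using assms by (cases k) auto
  then show "coeff (weighted_deriv \<beta> (laguerre_diff \<beta> k)) n
      = coeff (smult (- \<beta> / 2) (laguerre_poly \<beta> k + laguerre_poly \<beta> (k - 1))) n"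
    by (simp add: weighted_deriv_def laguerre_diff_def pderiv_diff pderiv_laguerre_poly_Suc
        field_simps)
qed

text \<open>
  Each factor involves two neighbouring Laguerre polynomials, as a sum in the derivative part and as a
  difference in the other. Pairs with adjacent indices share one Laguerre polynomial, which enters the
  first part with sign \<open>+\<close> and the second with sign \<open>-\<close>; this is where the minus in
  \<open>\<beta> / 4 - \<gamma> / \<beta>\<close> comes from.
\<close>

lemma poly_form_laguerre_diff:
  assumes "\<beta> > 0" "k \<ge> 1" "j \<ge> 1"
  shows "poly_form \<beta> \<gamma> (laguerre_diff \<beta> k) (laguerre_diff \<beta> j)
       = (if k = j then \<beta> / 2 + 2 * \<gamma> / \<beta>
          else if k = Suc j \<or> j = Suc k then \<beta> / 4 - \<gamma> / \<beta> else 0)"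
proof -
  let ?L = "laguerre_poly \<beta>"
  obtain k' j' where [simp]: "k = Suc k'" "j = Suc j'"
    using assms by (cases k; cases j) auto
  have "poly_form \<beta> \<gamma> (laguerre_diff \<beta> k) (laguerre_diff \<beta> j)
      = \<beta>\<^sup>2 / 4 * exp_integral \<beta> ((?L k + ?L k') * (?L j + ?L j'))
        + \<gamma> * exp_integral \<beta> ((?L k - ?L k') * (?L j - ?L j'))"
    unfolding poly_form_def weighted_deriv_laguerre_diff[OF assms(2)]
      weighted_deriv_laguerre_diff[OF assms(3)]
    by (simp add: laguerre_diff_def exp_integral_smult power2_eq_square)
  also have "exp_integral \<beta> ((?L k + ?L k') * (?L j + ?L j'))
      = exp_integral \<beta> (?L k * ?L j) + exp_integral \<beta> (?L k * ?L j')
        + exp_integral \<beta> (?L k' * ?L j) + exp_integral \<beta> (?L k' * ?L j')"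
    by (simp only: distrib_left distrib_right exp_integral_add[OF assms(1)])
  also have "exp_integral \<beta> ((?L k - ?L k') * (?L j - ?L j'))
      = exp_integral \<beta> (?L k * ?L j) - exp_integral \<beta> (?L k * ?L j')
        - exp_integral \<beta> (?L k' * ?L j) + exp_integral \<beta> (?L k' * ?L j')"
    by (simp only: left_diff_distrib right_diff_distrib exp_integral_diff[OF assms(1)])
  finally show ?thesis
    using assms(1) by (auto simp: laguerre_orthogonal field_simps power2_eq_square)
qed

section \<open>Gram--Schmidt for a tridiagonal Gram matrix\<close>

text \<open>
  Polynomials of exact degrees \<open>1, 2, ..., n\<close> vanishing at zero span all polynomials of degree at most
  \<open>n\<close> vanishing at zero: remove the leading term and continue. It is used for both the
  Laguerre basis and the Sobolev orthogonal one.
\<close>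

lemma triangular_expansion:
  fixes e :: "nat \<Rightarrow> real poly"
  assumes deg: "\<And>j. 1 \<le> j \<Longrightarrow> degree (e j) \<le> j"
    and lead: "\<And>j. 1 \<le> j \<Longrightarrow> coeff (e j) j \<noteq> 0"
    and root: "\<And>j. 1 \<le> j \<Longrightarrow> poly (e j) 0 = 0"
    and "degree q \<le> n" "poly q 0 = 0"
  shows "\<exists>c. q = (\<Sum>j=1..n. smult (c j) (e j))"
  using assms(4,5)
proof (induction n arbitrary: q)
  case 0
  then have "q = 0"
    by (auto elim!: degree_eq_zeroE)
  then show ?case
    by simp
next
  case (Suc n)
  define a where "a = coeff q (Suc n) / coeff (e (Suc n)) (Suc n)"
  define r where "r = q - smult a (e (Suc n))"
  have "coeff r m = 0" if "m > n" for m
  proof (cases "m = Suc n")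
    case True
    then show ?thesis
      using lead[of "Suc n"] by (simp add: r_def a_def)
  next
    case False
    with that have "m > degree q" "m > degree (e (Suc n))"
      using Suc.prems(1) deg[of "Suc n"] by auto
    then show ?thesis
      by (simp add: r_def coeff_eq_0)
  qed
  then have "degree r \<le> n"
    by (intro degree_le) auto
  moreover have "poly r 0 = 0"
    using Suc.prems(2) root[of "Suc n"] by (simp add: r_def)
  ultimately obtain c where c: "r = (\<Sum>j=1..n. smult (c j) (e j))"
    using Suc.IH by blast
  have "(\<Sum>j=1..n. smult ((c(Suc n := a)) j) (e j)) = r"
    unfolding c by (rule sum.cong) auto
  then have "q = (\<Sum>j=1..Suc n. smult ((c(Suc n := a)) j) (e j))"
    by (simp add: r_def)
  then show ?case
    by blast
qed

lemma poly_form_laguerre_diff_orthogonal: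
  assumes "\<beta> > 0" and "degree q \<le> n" "poly q 0 = 0" and "Suc n < k"
  shows "poly_form \<beta> \<gamma> q (laguerre_diff \<beta> k) = 0"
proof -
  obtain c where c: "q = (\<Sum>j=1..n. smult (c j) (laguerre_diff \<beta> j))"
    using triangular_expansion[of "laguerre_diff \<beta>" q n] assms
    by (auto simp: degree_laguerre_diff poly_laguerre_diff_0 coeff_laguerre_diff)
  show ?thesis
    unfolding c poly_form_sum_left[OF assms(1)] poly_form_smult_left
    using assms by (intro sum.neutral) (simp add: poly_form_laguerre_diff)
qed

lemma orthogonal_sum_eq_0:
  assumes "\<beta> > 0"
    and orth: "\<And>i j. i \<in> I \<Longrightarrow> j \<in> I \<Longrightarrow> poly_form \<beta> \<gamma> (e i) (e j) = (if i = j then \<rho> i else 0)"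
    and "finite I" and nz: "\<And>i. i \<in> I \<Longrightarrow> \<rho> i \<noteq> 0"
    and w: "w = (\<Sum>j\<in>I. smult (c j) (e j))"
    and perp: "\<And>i. i \<in> I \<Longrightarrow> poly_form \<beta> \<gamma> w (e i) = 0"
  shows "w = 0"
proof -
  have "c i = 0" if "i \<in> I" for i
  proof -
    have "0 = (\<Sum>j\<in>I. c j * poly_form \<beta> \<gamma> (e j) (e i))"
      using perp[OF that] by (simp add: w poly_form_sum_left[OF assms(1)] poly_form_smult_left)
    also have "\<dots> = (\<Sum>j\<in>I. if j = i then c i * \<rho> i else 0)"
      using that by (intro sum.cong) (auto simp: orth)
    also have "\<dots> = c i * \<rho> i"
      using that \<open>finite I\<close> by simp
    finally show ?thesis
      using nz[OF that] by simp
  qed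
  then show ?thesis
    by (simp add: w)
qed

text \<open>
  The hypotheses say that \<open>P\<close> is an orthogonal family with \<open>P k - laguerre_diff \<beta> k\<close> in the span of
  the earlier basis elements. The squared norms \<open>\<rho> k\<close> are not assumed to be nonzero. Instead of
  positive definiteness of the integral form, the proof uses the recursion for \<open>\<rho>\<close> itself: as long as
  the earlier \<open>\<rho> i\<close> are at least \<open>a / 2\<close>, the step at \<open>k\<close> is valid and yields \<open>\<rho> k \<ge> a / 2\<close> again.
\<close>

lemma sobolev_laguerre_recurrence:
  fixes P :: "nat \<Rightarrow> real poly" and \<rho> :: "nat \<Rightarrow> real"
  assumes pos: "\<beta> > 0" "\<gamma> > 0"
    and corr_deg: "\<And>k. k \<ge> 1 \<Longrightarrow> degree (P k - laguerre_diff \<beta> k) \<le> k - 1"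
    and corr_root: "\<And>k. k \<ge> 1 \<Longrightarrow> poly (P k - laguerre_diff \<beta> k) 0 = 0"
    and orth: "\<And>k m. k \<ge> 1 \<Longrightarrow> m \<ge> 1 \<Longrightarrow> poly_form \<beta> \<gamma> (P k) (P m) = (if k = m then \<rho> k else 0)"
  defines "a \<equiv> \<beta> / 2 + 2 * \<gamma> / \<beta>" and "b \<equiv> \<beta> / 4 - \<gamma> / \<beta>"
  shows "P 1 = laguerre_diff \<beta> 1" and "\<rho> 1 = a"
    and "k \<ge> 2 \<Longrightarrow> P k = laguerre_diff \<beta> k - smult (b / \<rho> (k - 1)) (P (k - 1))"
    and "k \<ge> 2 \<Longrightarrow> \<rho> k = - ((b / \<rho> (k - 1))\<^sup>2 * \<rho> (k - 1)) + a"
proof -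
  let ?\<Lambda> = "laguerre_diff \<beta>" and ?B = "poly_form \<beta> \<gamma>"
  define R where "R k = P k - ?\<Lambda> k" for k
  have P_eq: "P k = ?\<Lambda> k + R k" for k
    by (simp add: R_def)
  have P_deg: "degree (P k) \<le> k" if "k \<ge> 1" for k
    unfolding P_eq using corr_deg[OF that, folded R_def] degree_laguerre_diff[of \<beta> k]
    by (intro degree_add_le) auto
  have P_root: "poly (P k) 0 = 0" if "k \<ge> 1" for k
    using corr_root[OF that] by (simp add: poly_laguerre_diff_0)
  have P_lead: "coeff (P k) k \<noteq> 0" if "k \<ge> 1" for k
  proof -
    have "coeff (R k) k = 0"
      using corr_deg[OF that] that unfolding R_def by (intro coeff_eq_0) auto
    then show ?thesis
      using pos(1) coeff_laguerre_diff[OF that, of \<beta>] by (simp add: P_eq)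
  qed
  have B_prev: "?B (?\<Lambda> k) (P (k - 1)) = b" if "k \<ge> 2" for k
  proof -
    have "?B (R (k - 1)) (?\<Lambda> k) = 0"
      using that corr_deg[of "k - 1"] corr_root[of "k - 1"] unfolding R_def
      by (intro poly_form_laguerre_diff_orthogonal[OF pos(1), of _ "k - 1 - 1"]) auto
    then show ?thesis
      using that pos(1) unfolding poly_form_commute[of \<beta> \<gamma> "?\<Lambda> k"] P_eq
      by (auto simp: poly_form_add_left poly_form_laguerre_diff b_def)
  qed
  have B_far: "?B (?\<Lambda> k) (P i) = 0" if "i \<ge> 1" "Suc i < k" for i k
    using poly_form_laguerre_diff_orthogonal[OF pos(1) P_deg P_root] that
    by (subst poly_form_commute) auto
  have R_1: "R 1 = 0"
    using corr_deg[of 1, folded R_def] corr_root[of 1, folded R_def]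
    by (auto elim!: degree_eq_zeroE)
  then show P_1: "P 1 = ?\<Lambda> 1"
    by (simp add: R_def)
  show rho_1: "\<rho> 1 = a"
    using orth[of 1 1] pos(1) unfolding P_1 by (simp add: poly_form_laguerre_diff a_def)
  have step: "P k = ?\<Lambda> k - smult (b / \<rho> (k - 1)) (P (k - 1))"
      "\<rho> k = - ((b / \<rho> (k - 1))\<^sup>2 * \<rho> (k - 1)) + a"
    if k: "k \<ge> 2" and nz: "\<And>i. 1 \<le> i \<Longrightarrow> i < k \<Longrightarrow> \<rho> i \<noteq> 0" for k
  proof -
    define d where "d = b / \<rho> (k - 1)"
    have d_rho: "d * \<rho> (k - 1) = b"
      using nz[of "k - 1"] k by (simp add: d_def)
    \<comment> \<open>The claimed recurrence is \<open>w = 0\<close>.\<close>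
    define w where "w = R k + smult d (P (k - 1))"
    have "degree w \<le> k - 1"
      unfolding w_def R_def using k corr_deg[of k] P_deg[of "k - 1"]
      by (intro degree_add_le order_trans[OF degree_smult_le]) auto
    moreover have "poly w 0 = 0"
      using k corr_root[of k] P_root[of "k - 1"] by (simp add: w_def R_def)
    ultimately obtain c where c: "w = (\<Sum>j=1..k - 1. smult (c j) (P j))"
      using triangular_expansion[of P w "k - 1", OF P_deg P_lead P_root] by blast
    have w_eq: "w = P k - ?\<Lambda> k + smult d (P (k - 1))"
      by (simp add: w_def R_def)
    have "w = 0"
    proof (rule orthogonal_sum_eq_0[OF pos(1) _ _ _ c])
      fix i
      assume i: "i \<in> {1..k - 1}"
      show "\<rho> i \<noteq> 0"
        by (rule nz) (use i k in auto)
      have "?B w (P i) = - ?B (?\<Lambda> k) (P i) + d * ?B (P (k - 1)) (P i)"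
        unfolding w_eq using i k
        by (auto simp: poly_form_add_left[OF pos(1)] poly_form_diff_left[OF pos(1)]
            poly_form_smult_left orth)
      also have "\<dots> = 0"
      proof (cases "i = k - 1")
        case True
        with k show ?thesis
          using B_prev[OF k] d_rho by (simp add: orth)
      next
        case False
        with i k show ?thesis
          using B_far[of i k] by (auto simp: orth)
      qed
      finally show "?B w (P i) = 0" .
    qed (auto simp: orth)
    then show Pk: "P k = ?\<Lambda> k - smult (b / \<rho> (k - 1)) (P (k - 1))"
      by (simp add: w_eq d_def algebra_simps)
    have "?B (P (k - 1)) (P k) = 0"
      using k by (simp add: orth)
    moreover have "?B (?\<Lambda> k) (P k) = a - d * b"
      unfolding poly_form_commute[of \<beta> \<gamma> "?\<Lambda> k"]
      unfolding Pk d_def[symmetric]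
      using k pos(1) B_prev[OF k] poly_form_commute[of \<beta> \<gamma> "?\<Lambda> k" "P (k - 1)"]
      by (simp add: poly_form_diff_left poly_form_smult_left poly_form_laguerre_diff a_def)
    moreover have "\<rho> k = ?B (?\<Lambda> k - smult d (P (k - 1))) (P k)"
      using k orth[of k k] unfolding Pk[folded d_def, symmetric] by simp
    ultimately have rho_k: "\<rho> k = a - d * b"
      by (simp add: poly_form_diff_left[OF pos(1)] poly_form_smult_left)
    have "d\<^sup>2 * \<rho> (k - 1) = d * b"
      unfolding power2_eq_square mult.assoc d_rho ..
    then show "\<rho> k = - ((b / \<rho> (k - 1))\<^sup>2 * \<rho> (k - 1)) + a"
      unfolding d_def[symmetric] by (simp add: rho_k)
  qed
  \<comment> \<open>The value \<open>a / 2\<close> is preserved by \<open>\<rho> \<mapsto> a - b\<^sup>2 / \<rho>\<close> since \<open>(a / 2)\<^sup>2 - b\<^sup>2 = \<gamma>\<close> is positive.\<close>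
  have a_pos: "a > 0" and b_le: "b\<^sup>2 \<le> (a / 2)\<^sup>2"
  proof -
    show "a > 0"
      unfolding a_def using pos by (intro add_pos_pos) simp_all
    have "(a / 2)\<^sup>2 - b\<^sup>2 = \<gamma>"
      using pos by (simp add: a_def b_def power2_eq_square field_simps)
    then show "b\<^sup>2 \<le> (a / 2)\<^sup>2"
      using pos by simp
  qed
  have rho_ge: "a / 2 \<le> \<rho> k" if "k \<ge> 1" for k
    using that
  proof (induction k rule: less_induct)
    case (less k)
    show ?case
    proof (cases "k = 1")
      case True
      then show ?thesis
        using rho_1 a_pos by simp
    next
      case False
      with less.prems have k: "k \<ge> 2"
        by simp
      have nz: "\<rho> i \<noteq> 0" if "1 \<le> i" "i < k" for i
        using less.IH[of i] that a_pos by auto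
      have prev: "a / 2 \<le> \<rho> (k - 1)"
        using less.IH[of "k - 1"] k by simp
      then have "(b / \<rho> (k - 1))\<^sup>2 * \<rho> (k - 1) = b\<^sup>2 / \<rho> (k - 1)"
        using a_pos by (simp add: power2_eq_square)
      also have "\<dots> \<le> (a / 2)\<^sup>2 / (a / 2)"
        using prev a_pos b_le by (intro frac_le) auto
      also have "\<dots> = a / 2"
        using a_pos by (simp add: power2_eq_square)
      finally show ?thesis
        using step(2)[OF k nz] by simp
    qed
  qed
  then have nz: "\<rho> i \<noteq> 0" if "i \<ge> 1" for i
    using a_pos that by fastforce
  show "P k = ?\<Lambda> k - smult (b / \<rho> (k - 1)) (P (k - 1))" if "k \<ge> 2"
    using step(1)[OF that] nz by simp
  show "\<rho> k = - ((b / \<rho> (k - 1))\<^sup>2 * \<rho> (k - 1)) + a" if "k \<ge> 2"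
    using step(2)[OF that] nz by simp
qed

theorem lemma2:
  fixes \<beta> \<gamma> :: real
    and S :: "nat \<Rightarrow> real \<Rightarrow> real"
    and \<rho> :: "nat \<Rightarrow> real"
  assumes "\<beta> > 0" and "\<gamma> > 0"
    and "\<And>k. k \<ge> 1 \<Longrightarrow> S k \<in> X0 \<beta> k"
    and "\<And>k. k \<ge> 1 \<Longrightarrow> (\<lambda>x. S k x - laguerre_fun (-1) \<beta> k x) \<in> X0 \<beta> (k - 1)"
    and "\<And>k m. k \<ge> 1 \<Longrightarrow> m \<ge> 1 \<Longrightarrow>
           sobolev_form \<gamma> (S k) (S m) = \<rho> k * (if k = m then 1 else 0)"
  shows "let d = (\<lambda>j. \<beta> / (4 * \<rho> j) - \<gamma> / (\<beta> * \<rho> j)) in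
           (\<forall>x>0. S 1 x = laguerre_fun (-1) \<beta> 1 x) \<and>
           (\<forall>k\<ge>2. \<forall>x>0. S k x = laguerre_fun (-1) \<beta> k x - d (k - 1) * S (k - 1) x) \<and>
           \<rho> 1 = (4 * \<gamma> + \<beta>^2) / (2 * \<beta>) \<and>
           (\<forall>k\<ge>2. \<rho> k = - ((d (k - 1))^2 * \<rho> (k - 1)) + \<beta> / 2 + 2 * \<gamma> / \<beta>)"
proof -
  have lag: "laguerre_fun (-1) \<beta> k x = exp (- (1/2) * \<beta> * x) * poly (laguerre_diff \<beta> k) x"
    if "k \<ge> 1" for k x
    using that by (simp add: laguerre_fun_def laguerre_minus_one_eq)
  have "\<forall>k. \<exists>r. k \<ge> 1 \<longrightarrow> degree r \<le> k - 1 \<and> poly r 0 = 0 \<and>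
      (\<forall>x>0. S k x - laguerre_fun (-1) \<beta> k x = exp (- (1/2) * \<beta> * x) * poly r x)"
    using assms(4) unfolding X0_def by blast
  then obtain r where r: "\<And>k. k \<ge> 1 \<Longrightarrow> degree (r k) \<le> k - 1"
      "\<And>k. k \<ge> 1 \<Longrightarrow> poly (r k) 0 = 0"
      "\<And>k x. k \<ge> 1 \<Longrightarrow> x > 0 \<Longrightarrow>
         S k x - laguerre_fun (-1) \<beta> k x = exp (- (1/2) * \<beta> * x) * poly (r k) x"
    by metis
  define P where "P k = laguerre_diff \<beta> k + r k" for k
  have S: "S k x = exp (- (1/2) * \<beta> * x) * poly (P k) x" if "k \<ge> 1" "x > 0" for k x
    using r(3)[OF that] lag[OF that(1), of x] by (simp add: P_def distrib_left)
  have orth: "poly_form \<beta> \<gamma> (P k) (P m) = (if k = m then \<rho> k else 0)" if "k \<ge> 1" "m \<ge> 1" for k m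
    using assms(5)[OF that] sobolev_form_exp_poly[OF S[OF that(1)] S[OF that(2)], of \<gamma>] by simp
  have P: "degree (P k - laguerre_diff \<beta> k) \<le> k - 1" "poly (P k - laguerre_diff \<beta> k) 0 = 0"
    if "k \<ge> 1" for k
    using r(1,2)[OF that] by (simp_all add: P_def)
  define d where "d j = \<beta> / (4 * \<rho> j) - \<gamma> / (\<beta> * \<rho> j)" for j
  have d_eq: "(\<beta> / 4 - \<gamma> / \<beta>) / \<rho> j = d j" for j
    by (simp add: d_def diff_divide_distrib)
  note rec = sobolev_laguerre_recurrence[OF assms(1,2) P orth, unfolded d_eq]
  have P_1: "P 1 = laguerre_diff \<beta> 1" and rho_1: "\<rho> 1 = \<beta> / 2 + 2 * \<gamma> / \<beta>"
    by (rule rec(1), assumption+) (rule rec(2), assumption+)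
  have P_rec: "P k = laguerre_diff \<beta> k - smult (d (k - 1)) (P (k - 1))" if "k \<ge> 2" for k
    by (rule rec(3)) (use that in simp_all)
  have rho_rec: "\<rho> k = - ((d (k - 1))\<^sup>2 * \<rho> (k - 1)) + (\<beta> / 2 + 2 * \<gamma> / \<beta>)"
    if "k \<ge> 2" for k
    by (rule rec(4)) (use that in simp_all)
  have "\<rho> 1 = (4 * \<gamma> + \<beta>\<^sup>2) / (2 * \<beta>)"
    using rho_1 assms(1) by (simp add: field_simps power2_eq_square)
  moreover have "S 1 x = laguerre_fun (-1) \<beta> 1 x" if "x > 0" for x
    using S[of 1 x] lag[of 1 x] P_1 that by simp
  moreover have "S k x = laguerre_fun (-1) \<beta> k x - d (k - 1) * S (k - 1) x"
    if "k \<ge> 2" "x > 0" for k x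
  proof -
    have "poly (P k) x = poly (laguerre_diff \<beta> k) x - d (k - 1) * poly (P (k - 1)) x"
      using P_rec[OF that(1)] by (metis poly_diff poly_smult)
    moreover have "k \<ge> 1" "k - 1 \<ge> 1"
      using that by auto
    ultimately show ?thesis
      using that(2) by (simp only: S lag) (simp add: algebra_simps)
  qed
  moreover have "\<rho> k = - ((d (k - 1))\<^sup>2 * \<rho> (k - 1)) + \<beta> / 2 + 2 * \<gamma> / \<beta>" if "k \<ge> 2" for k
    using rho_rec[OF that] by simp
  ultimately show ?thesis
    unfolding Let_def d_def by blast
qed

end
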